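(* Let $\theta>0$, $\beta>0$, $b\ge0$, $\lambda\ge1$, and consider the equilibrium asset prices of the model with contemporaneous gain-loss utility only (Model II), given by the explicit formulas in the context, under the growth condition $\beta\,\mathbb E_t[\varepsilon_{c,t+1}^{-\theta}\varepsilon_{d,t+1}]<1$. Then: (i) If $$F_{\varepsilon_c}(\varepsilon_{c,t})>\frac{\mathbb E[\varepsilon_{c,t+1}^{-\theta}F_{\varepsilon_c}(\varepsilon_{c,t+1})]}{\mathbb E[\varepsilon_{c,t+1}^{-\theta}]},$$ then the risk-free return $R_{f,t+1}$ is decreasing in $\lambda$ and in $b$; otherwise, $R_{f,t+1}$ is increasing in $\lambda$ and in $b$. (ii) If $$F_{\varepsilon_c}(\varepsilon_{c,t})>\frac{\mathbb E_t[\varepsilon_{c,t+1}^{-\theta}\varepsilon_{d,t+1}F_{\varepsilon_c}(\varepsilon_{c,t+1})]}{\mathbb E_t[\varepsilon_{c,t+1}^{-\theta}\varepsilon_{d,t+1}]},$$ then the price-dividend ratio $S_t/D_t$ is increasing in $\lambda$ and in $b$; otherwise, $S_t/D_t$ is decreasing in $\lambda$ and in $b$.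
   Context: $\bar C_t>0$ is aggregate consumption, $D_t>0$ dividends, $S_t$ the stock price, $\varepsilon_{c,t+1}=\bar C_{t+1}/\bar C_t$, $\varepsilon_{d,t+1}=D_{t+1}/D_t$, $Y_t=\bar C_t/D_t$, so $\varepsilon_{d,t+1}=\varepsilon_{c,t+1}Y_t/Y_{t+1}$. $\mathcal F_t$ is the filtration generated by the consumption and dividend growth rates up to $t$ (initial levels known), $\mathbb E_t=\mathbb E[\cdot\mid\mathcal F_t]$. The $\varepsilon_{c,t}$ are i.i.d. with continuous CDF $F_{\varepsilon_c}$, $\varepsilon_{c,t+1}$ is independent of $\mathcal F_t$, and $\{Y_t\}$ is a Markov chain. The laws of these exogenous processes do not depend on the preference parameters: $\theta$ (relative risk aversion), $\beta$ (discount factor), $b$ (weight of gain-loss utility), $\lambda$ (degree of loss aversion). With $A(x)=1+bF_{\varepsilon_c}(x)+b\lambda(1-F_{\varepsilon_c}(x))$, the equilibrium risk-free return and price-dividend ratio of the model are $$R_{f,t+1}=\frac{A(\varepsilon_{c,t})}{\beta\,\mathbb E[\varepsilon_{c,t+1}^{-\theta}A(\varepsilon_{c,t+1})]},\qquad \frac{S_t}{D_t}=\frac{\beta\,\mathbb E_t[\varepsilon_{c,t+1}^{-\theta}\varepsilon_{d,t+1}A(\varepsilon_{c,t+1})]}{A(\varepsilon_{c,t})\big(1-\beta\,\mathbb E_t[\varepsilon_{c,t+1}^{-\theta}\varepsilon_{d,t+1}]\big)}.$$ Monotonicity in $\lambda$ (on $[1,\infty)$) and in $b$ (on $[0,\infty)$)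 is understood separately in each parameter with everything else held fixed, and in the weak sense. The expectations appearing in the formulas are assumed finite. *)

theory Defs
  imports "HOL-Probability.Probability"
begin

text \<open>Growth rate from \<open>t - 1\<close> to \<open>t\<close>. It is only meaningful for \<open>t \<ge> 1\<close>; at \<open>t = 0\<close>
  truncated subtraction makes it \<open>X 0 / X 0\<close>, and no growth rate with index 0 is used below.\<close>

definition growth :: "(nat \<Rightarrow> 'a \<Rightarrow> real) \<Rightarrow> nat \<Rightarrow> 'a \<Rightarrow> real" where
  "growth X t \<omega> = X t \<omega> / X (t - 1) \<omega>"

definition generated_algebra :: "'a measure \<Rightarrow> ('i \<Rightarrow> 'a \<Rightarrow> real) \<Rightarrow> 'i set \<Rightarrow> 'a measure" where
  "generated_algebra M X I = sigma (space M) (\<Union>i\<in>I. {X i -` B \<inter> space M | B. B \<in> sets borel})"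

definition growth_filtration ::
    "'a measure \<Rightarrow> (nat \<Rightarrow> 'a \<Rightarrow> real) \<Rightarrow> (nat \<Rightarrow> 'a \<Rightarrow> real) \<Rightarrow> nat \<Rightarrow> 'a measure" where
  "growth_filtration M C D t =
     generated_algebra M (case_sum (growth C) (growth D)) ({1..t} <+> {1..t})"

text \<open>Markov property with respect to the history of the process itself; the chain is not
  assumed to be time-homogeneous, nor its state space to be discrete.\<close>

definition markov_chain :: "'a measure \<Rightarrow> (nat \<Rightarrow> 'a \<Rightarrow> real) \<Rightarrow> bool" where
  "markov_chain M Y \<longleftrightarrow>
     (\<forall>t. Y t \<in> borel_measurable M) \<and>
     (\<forall>t. \<forall>B\<in>sets borel. AE \<omega> in M.
        real_cond_exp M (generated_algebra M Y {0..t}) (\<lambda>\<omega>'. indicator B (Y (Suc t) \<omega>')) \<omega> =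
        real_cond_exp M (generated_algebra M Y {t}) (\<lambda>\<omega>'. indicator B (Y (Suc t) \<omega>')) \<omega>)"

locale consumption_dividend_economy = prob_space M for M :: "'a measure" +
  fixes C D :: "nat \<Rightarrow> 'a \<Rightarrow> real"
  assumes consumption_measurable: "C t \<in> borel_measurable M"
    and dividend_measurable: "D t \<in> borel_measurable M"
    and consumption_pos: "\<omega> \<in> space M \<Longrightarrow> C t \<omega> > 0"
    and dividend_pos: "\<omega> \<in> space M \<Longrightarrow> D t \<omega> > 0"
    and initial_levels_known: "\<exists>c d. \<forall>\<omega>\<in>space M. C 0 \<omega> = c \<and> D 0 \<omega> = d"
    and consumption_growth_indep: "indep_vars (\<lambda>_. borel) (growth C) {1..}"
    and consumption_growth_ident:
      "t \<ge> 1 \<Longrightarrow> distr M borel (growth C t) = distr M borel (growth C 1)"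
    and consumption_growth_cdf_continuous:
      "continuous_on UNIV (cdf (distr M borel (growth C 1)))"
    and consumption_growth_indep_past:
      "indep_set {growth C (Suc t) -` B \<inter> space M | B. B \<in> sets borel}
                 (sets (growth_filtration M C D t))"
    and consumption_dividend_markov: "markov_chain M (\<lambda>t \<omega>. C t \<omega> / D t \<omega>)"

definition growth_cdf :: "'a measure \<Rightarrow> (nat \<Rightarrow> 'a \<Rightarrow> real) \<Rightarrow> real \<Rightarrow> real" where
  "growth_cdf M C = cdf (distr M borel (growth C 1))"

definition gain_loss_factor ::
    "'a measure \<Rightarrow> (nat \<Rightarrow> 'a \<Rightarrow> real) \<Rightarrow> real \<Rightarrow> real \<Rightarrow> real \<Rightarrow> real" where
  "gain_loss_factor M C lam b x =
     1 + b * growth_cdf M C x + b * lam * (1 - growth_cdf M C x)"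

text \<open>The risk-free return \<open>R\<^sub>f\<close> from \<open>t\<close> to \<open>t + 1\<close>, known at time \<open>t\<close>.\<close>

definition risk_free_return ::
    "'a measure \<Rightarrow> (nat \<Rightarrow> 'a \<Rightarrow> real) \<Rightarrow> real \<Rightarrow> real \<Rightarrow> real \<Rightarrow> real \<Rightarrow> nat \<Rightarrow> 'a \<Rightarrow> real" where
  "risk_free_return M C \<theta> \<beta> lam b t \<omega> =
     gain_loss_factor M C lam b (growth C t \<omega>) /
     (\<beta> * (\<integral>\<omega>'. growth C (Suc t) \<omega>' powr (-\<theta>) *
                 gain_loss_factor M C lam b (growth C (Suc t) \<omega>') \<partial>M))"

text \<open>The price-dividend ratio at time \<open>t\<close>. As it involves conditional expectations, for each
  choice of the parameters it is determined only up to a null set.\<close>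

definition price_dividend_ratio ::
    "'a measure \<Rightarrow> (nat \<Rightarrow> 'a \<Rightarrow> real) \<Rightarrow> (nat \<Rightarrow> 'a \<Rightarrow> real) \<Rightarrow>
     real \<Rightarrow> real \<Rightarrow> real \<Rightarrow> real \<Rightarrow> nat \<Rightarrow> 'a \<Rightarrow> real" where
  "price_dividend_ratio M C D \<theta> \<beta> lam b t \<omega> =
     \<beta> * real_cond_exp M (growth_filtration M C D t)
           (\<lambda>\<omega>'. growth C (Suc t) \<omega>' powr (-\<theta>) * growth D (Suc t) \<omega>' *
                 gain_loss_factor M C lam b (growth C (Suc t) \<omega>')) \<omega> /
     (gain_loss_factor M C lam b (growth C t \<omega>) *
      (1 - \<beta> * real_cond_exp M (growth_filtration M C D t)
           (\<lambda>\<omega>'. growth C (Suc t) \<omega>' powr (-\<theta>) * growth D (Suc t) \<omega>') \<omega>))"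

text \<open>Weak monotonicity in each of \<open>lam \<ge> 1\<close> and \<open>b \<ge> 0\<close> separately, the other one being fixed.\<close>

definition increasing_in_each :: "(real \<Rightarrow> real \<Rightarrow> real) \<Rightarrow> bool" where
  "increasing_in_each f \<longleftrightarrow>
     (\<forall>b\<ge>0. mono_on {1..} (\<lambda>lam. f lam b)) \<and> (\<forall>lam\<ge>1. mono_on {0..} (\<lambda>b. f lam b))"

definition decreasing_in_each :: "(real \<Rightarrow> real \<Rightarrow> real) \<Rightarrow> bool" where
  "decreasing_in_each f \<longleftrightarrow>
     (\<forall>b\<ge>0. antimono_on {1..} (\<lambda>lam. f lam b)) \<and> (\<forall>lam\<ge>1. antimono_on {0..} (\<lambda>b. f lam b))"

text \<open>\<open>g\<close> is a version of the family \<open>f\<close>: for each admissible \<open>lam\<close> and \<open>b\<close> separately, the two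
  random variables agree almost surely. When each \<open>f lam b\<close> is given only up to a null set, a
  pathwise statement about uncountably many parameters at once is meaningful only for a version.
  If some version is almost surely monotone in a parameter, then for any two values of the
  parameter the corresponding inequality between the values of \<open>f\<close> holds almost surely.\<close>

definition version_of ::
    "'a measure \<Rightarrow> (real \<Rightarrow> real \<Rightarrow> 'a \<Rightarrow> real) \<Rightarrow> (real \<Rightarrow> real \<Rightarrow> 'a \<Rightarrow> real) \<Rightarrow> bool" where
  "version_of M f g \<longleftrightarrow> (\<forall>lam\<ge>1. \<forall>b\<ge>0. g lam b \<in> borel_measurable M \<and>
     (AE \<omega> in M. g lam b \<omega> = f lam b \<omega>))"

end

theory Submission
  imports Defs
begin

text \<open>Write \<open>a(p) = 1 + b p + b \<lambda> (1 - p)\<close>, so that the gain-loss factor is \<open>a \<circ> F\<close>. As \<open>a\<close> is affine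
  in \<open>p\<close>, a weighted (conditional) mean of \<open>a(F(\<epsilon>))\<close> is the total weight times \<open>a(m)\<close>, where \<open>m\<close> is
  the weighted mean of \<open>F(\<epsilon>)\<close>. Hence, up to positive factors free of \<open>\<lambda>\<close> and \<open>b\<close>, the return is
  \<open>a(F(\<epsilon>\<^sub>t)) / a(m)\<close> and the price-dividend ratio is almost surely \<open>a(m) / a(F(\<epsilon>\<^sub>t))\<close>. The sign of the variation of
  such a ratio \<open>a(p) / a(q)\<close> in \<open>\<lambda>\<close> or \<open>b\<close> is that of \<open>q - p\<close>.\<close>

section \<open>Algebra of the gain-loss weight\<close>

definition gain_loss_weight :: "real \<Rightarrow> real \<Rightarrow> real \<Rightarrow> real" where
  "gain_loss_weight lam b p = 1 + b * p + b * lam * (1 - p)"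

lemma gain_loss_factor_eq_weight:
  "gain_loss_factor M C lam b x = gain_loss_weight lam b (growth_cdf M C x)"
  by (simp add: gain_loss_factor_def gain_loss_weight_def)

lemma gain_loss_weight_pos:
  assumes "0 \<le> b" "0 \<le> lam" "0 \<le> p" "p \<le> 1"
  shows "gain_loss_weight lam b p > 0"
proof -
  have "0 \<le> b * p" "0 \<le> b * lam * (1 - p)"
    using assms by simp_all
  then show ?thesis
    unfolding gain_loss_weight_def by linarith
qed

text \<open>Here \<open>u\<close> stands for a total weight and \<open>v\<close> for the weighted
  total of \<open>p\<close>. The weight is \<open>(1 + b * lam) + b * (1 - lam) * p\<close>, so
  averaging it gives the left side, for integrals and for conditional expectations alike.\<close>

lemma weighted_gain_loss:
  assumes "u \<noteq> 0"
  shows "(1 + b * lam) * u + b * (1 - lam) * v = u * gain_loss_weight lam b (v / u)"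
  using assms by (simp add: gain_loss_weight_def field_simps)

lemma gain_loss_ratio_mono_lam:
  assumes "0 \<le> b" "1 \<le> lam" "lam \<le> lam'" "0 \<le> p" "p \<le> q" "q \<le> 1"
  shows "gain_loss_weight lam b p / gain_loss_weight lam b q
       \<le> gain_loss_weight lam' b p / gain_loss_weight lam' b q"
    and "gain_loss_weight lam' b q / gain_loss_weight lam' b p
       \<le> gain_loss_weight lam b q / gain_loss_weight lam b p"
proof -
  \<comment> \<open>Cross-multiplication reduces both claims to the sign of this one determinant,
    which factorises.\<close>
  have "gain_loss_weight lam' b p * gain_loss_weight lam b q
      - gain_loss_weight lam b p * gain_loss_weight lam' b q
      = (lam' - lam) * (b * (1 + b)) * (q - p)"
    by (simp add: gain_loss_weight_def algebra_simps)
  moreover have "\<dots> \<ge> 0"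
    using assms by simp
  ultimately have "gain_loss_weight lam b p * gain_loss_weight lam' b q
      \<le> gain_loss_weight lam' b p * gain_loss_weight lam b q"
    by linarith
  moreover have "gain_loss_weight l b r > 0" if "l \<in> {lam, lam'}" "r \<in> {p, q}" for l r
    using assms that by (intro gain_loss_weight_pos) auto
  ultimately show "gain_loss_weight lam b p / gain_loss_weight lam b q
       \<le> gain_loss_weight lam' b p / gain_loss_weight lam' b q"
    and "gain_loss_weight lam' b q / gain_loss_weight lam' b p
       \<le> gain_loss_weight lam b q / gain_loss_weight lam b p"
    by (simp_all add: divide_le_eq le_divide_eq pos_divide_le_eq mult.commute)
qed

lemma gain_loss_ratio_mono_b:
  assumes "0 \<le> b" "b \<le> b'" "1 \<le> lam" "0 \<le> p" "p \<le> q" "q \<le> 1"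
  shows "gain_loss_weight lam b p / gain_loss_weight lam b q
       \<le> gain_loss_weight lam b' p / gain_loss_weight lam b' q"
    and "gain_loss_weight lam b' q / gain_loss_weight lam b' p
       \<le> gain_loss_weight lam b q / gain_loss_weight lam b p"
proof -
  \<comment> \<open>In \<open>b\<close> the weight is affine with intercept 1 and slope
    \<open>lam - (lam - 1) * p\<close>, so only the difference of the slopes at \<open>p\<close> and
    \<open>q\<close> survives; \<open>lam \<ge> 1\<close> fixes its sign.\<close>
  have "gain_loss_weight lam b' p * gain_loss_weight lam b q
      - gain_loss_weight lam b p * gain_loss_weight lam b' q
      = (b' - b) * (lam - 1) * (q - p)"
    by (simp add: gain_loss_weight_def algebra_simps)
  moreover have "\<dots> \<ge> 0"
    using assms by simp
  ultimately have "gain_loss_weight lam b p * gain_loss_weight lam b' q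
      \<le> gain_loss_weight lam b' p * gain_loss_weight lam b q"
    by linarith
  moreover have "gain_loss_weight lam c r > 0" if "c \<in> {b, b'}" "r \<in> {p, q}" for c r
    using assms that by (intro gain_loss_weight_pos) auto
  ultimately show "gain_loss_weight lam b p / gain_loss_weight lam b q
       \<le> gain_loss_weight lam b' p / gain_loss_weight lam b' q"
    and "gain_loss_weight lam b' q / gain_loss_weight lam b' p
       \<le> gain_loss_weight lam b q / gain_loss_weight lam b p"
    by (simp_all add: divide_le_eq le_divide_eq pos_divide_le_eq mult.commute)
qed

text \<open>The factor \<open>k\<close> collects what is free of \<open>lam\<close> and
  \<open>b\<close>. With \<open>f\<close> arbitrary, both prices fit: the date-\<open>t\<close>
  weight is in the numerator for the return and in the denominator for the price-dividend
  ratio.\<close>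

lemma increasing_gain_loss_ratio:
  assumes "0 \<le> k" "0 \<le> p" "p \<le> q" "q \<le> 1"
    and f: "\<And>lam b. 1 \<le> lam \<Longrightarrow> 0 \<le> b \<Longrightarrow>
      f lam b = k * (gain_loss_weight lam b p / gain_loss_weight lam b q)"
  shows "increasing_in_each f"
  unfolding increasing_in_each_def monotone_on_def
  using assms(1-4)
  \<comment> \<open>Keeping \<open>k\<close> outside the quotient lets \<open>mult_left_mono\<close>
    apply.\<close>
  by (auto simp: f gain_loss_ratio_mono_lam gain_loss_ratio_mono_b
      simp del: times_divide_eq_right intro!: mult_left_mono)

lemma decreasing_gain_loss_ratio:
  assumes "0 \<le> k" "0 \<le> q" "q \<le> p" "p \<le> 1"
    and f: "\<And>lam b. 1 \<le> lam \<Longrightarrow> 0 \<le> b \<Longrightarrow>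
      f lam b = k * (gain_loss_weight lam b p / gain_loss_weight lam b q)"
  shows "decreasing_in_each f"
  unfolding decreasing_in_each_def monotone_on_def
  using assms(1-4)
  by (auto simp: f gain_loss_ratio_mono_lam gain_loss_ratio_mono_b
      simp del: times_divide_eq_right intro!: mult_left_mono)

section \<open>Measurability and integrability in the economy\<close>

context consumption_dividend_economy
begin

lemma growth_measurable [measurable]:
  "growth C s \<in> borel_measurable M" "growth D s \<in> borel_measurable M"
  using consumption_measurable dividend_measurable by (auto simp: growth_def[abs_def])

lemma growth_pos:
  assumes "\<omega> \<in> space M"
  shows "growth C s \<omega> > 0" "growth D s \<omega> > 0"
  using consumption_pos dividend_pos assms by (simp_all add: growth_def)

lemma growth_cdf_bounds: "0 \<le> growth_cdf M C x" "growth_cdf M C x \<le> 1"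
proof -
  interpret G: real_distribution "distr M borel (growth C 1)"
    by (rule real_distribution_distr) simp
  show "0 \<le> growth_cdf M C x" "growth_cdf M C x \<le> 1"
    unfolding growth_cdf_def by (rule G.cdf_nonneg G.cdf_bounded_prob)+
qed

lemma growth_cdf_measurable [measurable]: "growth_cdf M C \<in> borel_measurable borel"
  unfolding growth_cdf_def
  by (rule borel_measurable_continuous_onI[OF consumption_growth_cdf_continuous])

text \<open>The CDF has values in [0,1], so \<open>w\<close> dominates the product. Finiteness of
  the plain moments thus yields all the other expectations.\<close>

lemma integrable_times_growth_cdf:
  assumes "integrable M w"
  shows "integrable M (\<lambda>\<omega>. w \<omega> * growth_cdf M C (growth C s \<omega>))"
proof (rule Bochner_Integration.integrable_bound[OF assms])
  show "(\<lambda>\<omega>. w \<omega> * growth_cdf M C (growth C s \<omega>)) \<in> borel_measurable M"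
    using assms by measurable
  show "AE \<omega> in M. norm (w \<omega> * growth_cdf M C (growth C s \<omega>)) \<le> norm (w \<omega>)"
    using growth_cdf_bounds by (intro AE_I2) (simp add: abs_mult mult_left_le)
qed

lemma subalgebra_growth_filtration: "subalgebra M (growth_filtration M C D t)"
proof -
  let ?A = "\<Union>i\<in>{1..t} <+> {1..t}.
    {case_sum (growth C) (growth D) i -` B \<inter> space M | B. B \<in> sets borel}"
  have "case_sum (growth C) (growth D) i \<in> borel_measurable M" for i
    by (cases i) simp_all
  then have "?A \<subseteq> sets M"
    by (intro UN_least) (blast intro: measurable_sets)
  then have "?A \<subseteq> Pow (space M)" "sigma_sets (space M) ?A \<subseteq> sets M"
    by (rule subset_trans[OF _ sets.space_closed], rule sets.sigma_sets_subset)
  then show ?thesis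
    unfolding growth_filtration_def generated_algebra_def subalgebra_def
    by (simp only: sets_measure_of space_measure_of simp_thms)
qed

end

text \<open>Makes the rules for conditional expectations available at every date; \<open>t\<close>
  becomes a parameter of each of them.\<close>

sublocale consumption_dividend_economy \<subseteq> finite_measure_subalgebra M "growth_filtration M C D t" for t
  using subalgebra_growth_filtration by unfold_locales

section \<open>Expectations of the gain-loss factor\<close>

context consumption_dividend_economy
begin

text \<open>The quotient \<open>v / u\<close> is the mean of the CDF under the density
  \<open>w / u\<close>, hence lies in [0,1], as the ratio lemmas require.\<close>

lemma risk_free_return_eq:
  fixes \<theta> :: real and t :: nat
  defines "w \<equiv> \<lambda>\<omega>. growth C (Suc t) \<omega> powr (-\<theta>)"
  defines "u \<equiv> \<integral>\<omega>. w \<omega> \<partial>M"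
    and "v \<equiv> \<integral>\<omega>. w \<omega> * growth_cdf M C (growth C (Suc t) \<omega>) \<partial>M"
  assumes "integrable M w"
  shows "0 < u" "0 \<le> v / u" "v / u \<le> 1"
    and "risk_free_return M C \<theta> \<beta> lam b t \<omega> = 1 / (\<beta> * u) *
      (gain_loss_weight lam b (growth_cdf M C (growth C t \<omega>)) / gain_loss_weight lam b (v / u))"
proof -
  let ?F = "\<lambda>\<omega>. growth_cdf M C (growth C (Suc t) \<omega>)"
  have w: "w \<omega> > 0" if "\<omega> \<in> space M" for \<omega>
    using growth_pos(1)[OF that, of "Suc t"] by (simp add: w_def)
  have int: "integrable M (\<lambda>\<omega>. w \<omega> * ?F \<omega>)"
    using assms(4) by (rule integrable_times_growth_cdf)
  show u: "0 < u"
    \<comment> \<open>The inequality is strict because \<open>w\<close> is positive on a space of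
      measure 1.\<close>
    unfolding u_def using w emeasure_space_1
    by (intro integral_less_AE_space[of "\<lambda>_. 0", simplified] assms(4)) auto
  have "0 \<le> v" unfolding v_def
    using w growth_cdf_bounds by (intro integral_nonneg_AE AE_I2) (simp add: less_imp_le)
  moreover have "v \<le> u" unfolding u_def v_def
    using w growth_cdf_bounds by (intro integral_mono int assms(4)) (simp add: less_imp_le mult_left_le)
  ultimately show "0 \<le> v / u" "v / u \<le> 1" using u by simp_all
  have "(\<integral>\<omega>. w \<omega> * gain_loss_weight lam b (?F \<omega>) \<partial>M)
      = (\<integral>\<omega>. (1 + b * lam) * w \<omega> + b * (1 - lam) * (w \<omega> * ?F \<omega>) \<partial>M)"
    by (intro Bochner_Integration.integral_cong) (simp_all add: gain_loss_weight_def algebra_simps)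
  also have "\<dots> = (1 + b * lam) * u + b * (1 - lam) * v"
    using int assms(4) by (simp add: u_def v_def)
  also have "\<dots> = u * gain_loss_weight lam b (v / u)"
    using u by (intro weighted_gain_loss) simp
  finally show "risk_free_return M C \<theta> \<beta> lam b t \<omega> = 1 / (\<beta> * u) *
      (gain_loss_weight lam b (growth_cdf M C (growth C t \<omega>)) / gain_loss_weight lam b (v / u))"
    by (simp add: risk_free_return_def gain_loss_factor_eq_weight w_def)
qed

text \<open>By linearity, \<open>lam\<close> and \<open>b\<close> enter only through coefficients of
  two fixed random variables. The null set may still depend on them.\<close>

lemma cond_exp_times_gain_loss:
  assumes int: "integrable M w"
  shows "AE \<omega> in M. real_cond_exp M (growth_filtration M C D t)
        (\<lambda>\<omega>. w \<omega> * gain_loss_factor M C lam b (growth C s \<omega>)) \<omega> =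
      (1 + b * lam) * real_cond_exp M (growth_filtration M C D t) w \<omega> +
      b * (1 - lam) * real_cond_exp M (growth_filtration M C D t)
        (\<lambda>\<omega>. w \<omega> * growth_cdf M C (growth C s \<omega>)) \<omega>"
proof -
  let ?G = "growth_filtration M C D t" and ?wF = "\<lambda>\<omega>. w \<omega> * growth_cdf M C (growth C s \<omega>)"
  have intF: "integrable M ?wF"
    using int by (rule integrable_times_growth_cdf)
  have "(\<lambda>\<omega>. w \<omega> * gain_loss_factor M C lam b (growth C s \<omega>))
      = (\<lambda>\<omega>. (1 + b * lam) * w \<omega> + b * (1 - lam) * ?wF \<omega>)"
    by (simp add: gain_loss_factor_def algebra_simps)
  moreover have "AE \<omega> in M. real_cond_exp M ?G (\<lambda>\<omega>. (1 + b * lam) * w \<omega> + b * (1 - lam) * ?wF \<omega>) \<omega>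
      = real_cond_exp M ?G (\<lambda>\<omega>. (1 + b * lam) * w \<omega>) \<omega> + real_cond_exp M ?G (\<lambda>\<omega>. b * (1 - lam) * ?wF \<omega>) \<omega>"
    using int intF by (intro real_cond_exp_add) simp_all
  ultimately show ?thesis
    using real_cond_exp_cmult[OF int, of t "1 + b * lam"] real_cond_exp_cmult[OF intF, of t "b * (1 - lam)"]
    by auto
qed

text \<open>Conditional counterpart of the bounds on \<open>v / u\<close>: monotonicity of
  conditional expectation gives \<open>0 \<le> V \<le> U\<close>, and positivity of \<open>w\<close>
  passes strictly to \<open>U\<close>.\<close>

lemma cond_exp_growth_cdf_bounds:
  fixes s t :: nat
  assumes int: "integrable M w" and pos: "\<forall>\<omega>\<in>space M. 0 < w \<omega>"
  defines "U \<equiv> real_cond_exp M (growth_filtration M C D t) w"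
    and "V \<equiv> real_cond_exp M (growth_filtration M C D t) (\<lambda>\<omega>. w \<omega> * growth_cdf M C (growth C s \<omega>))"
  shows "AE \<omega> in M. 0 < U \<omega> \<and> 0 \<le> V \<omega> / U \<omega> \<and> V \<omega> / U \<omega> \<le> 1"
proof -
  have intF: "integrable M (\<lambda>\<omega>. w \<omega> * growth_cdf M C (growth C s \<omega>))"
    using int by (rule integrable_times_growth_cdf)
  have "AE \<omega> in M. U \<omega> > 0"
    unfolding U_def using pos by (intro real_cond_exp_gr_c int AE_I2) simp
  moreover have "AE \<omega> in M. V \<omega> \<ge> 0"
    unfolding V_def using pos growth_cdf_bounds by (intro real_cond_exp_ge_c intF AE_I2) (simp add: less_imp_le)
  moreover have "AE \<omega> in M. V \<omega> \<le> U \<omega>"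
    unfolding U_def V_def using pos growth_cdf_bounds
    by (intro real_cond_exp_mono int intF AE_I2) (simp add: less_imp_le mult_left_le)
  ultimately show ?thesis by eventually_elim simp
qed

end

section \<open>Monotonicity of the two prices in the preference parameters\<close>

theorem proposition3:
  fixes M :: "'a measure" and C D :: "nat \<Rightarrow> 'a \<Rightarrow> real"
    and \<theta> \<beta> :: real and t :: nat
  defines "F \<equiv> growth_cdf M C"
    and "\<epsilon>c \<equiv> growth C" and "\<epsilon>d \<equiv> growth D"
    and "E \<equiv> real_cond_exp M (growth_filtration M C D t)"
  assumes economy: "consumption_dividend_economy M C D"
    and params: "\<theta> > 0" "\<beta> > 0"
    and t: "t \<ge> 1"
    and finite_expectations:
      "integrable M (\<lambda>\<omega>. \<epsilon>c (Suc t) \<omega> powr (-\<theta>))"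
      "integrable M (\<lambda>\<omega>. \<epsilon>c (Suc t) \<omega> powr (-\<theta>) * \<epsilon>d (Suc t) \<omega>)"
    and growth_condition:
      "AE \<omega> in M. \<beta> * E (\<lambda>\<omega>'. \<epsilon>c (Suc t) \<omega>' powr (-\<theta>) * \<epsilon>d (Suc t) \<omega>') \<omega> < 1"
  shows
    "(\<forall>\<omega>\<in>space M.
       if F (\<epsilon>c t \<omega>) >
            (\<integral>\<omega>'. \<epsilon>c (Suc t) \<omega>' powr (-\<theta>) * F (\<epsilon>c (Suc t) \<omega>') \<partial>M) /
            (\<integral>\<omega>'. \<epsilon>c (Suc t) \<omega>' powr (-\<theta>) \<partial>M)
       then decreasing_in_each (\<lambda>lam b. risk_free_return M C \<theta> \<beta> lam b t \<omega>)
       else increasing_in_each (\<lambda>lam b. risk_free_return M C \<theta> \<beta> lam b t \<omega>)) \<and>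
     (\<exists>PD. version_of M (\<lambda>lam b. price_dividend_ratio M C D \<theta> \<beta> lam b t) PD \<and>
       (AE \<omega> in M.
         if F (\<epsilon>c t \<omega>) >
              E (\<lambda>\<omega>'. \<epsilon>c (Suc t) \<omega>' powr (-\<theta>) * \<epsilon>d (Suc t) \<omega>' * F (\<epsilon>c (Suc t) \<omega>')) \<omega> /
              E (\<lambda>\<omega>'. \<epsilon>c (Suc t) \<omega>' powr (-\<theta>) * \<epsilon>d (Suc t) \<omega>') \<omega>
         then increasing_in_each (\<lambda>lam b. PD lam b \<omega>)
         else decreasing_in_each (\<lambda>lam b. PD lam b \<omega>)))"
proof (intro conjI)
  interpret consumption_dividend_economy M C D by (rule economy)
  note rf = risk_free_return_eq[OF finite_expectations(1)[unfolded \<epsilon>c_def]]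
  show "\<forall>\<omega>\<in>space M.
       if F (\<epsilon>c t \<omega>) >
            (\<integral>\<omega>'. \<epsilon>c (Suc t) \<omega>' powr (-\<theta>) * F (\<epsilon>c (Suc t) \<omega>') \<partial>M) /
            (\<integral>\<omega>'. \<epsilon>c (Suc t) \<omega>' powr (-\<theta>) \<partial>M)
       then decreasing_in_each (\<lambda>lam b. risk_free_return M C \<theta> \<beta> lam b t \<omega>)
       else increasing_in_each (\<lambda>lam b. risk_free_return M C \<theta> \<beta> lam b t \<omega>)"
    unfolding F_def \<epsilon>c_def using params rf(1-3) growth_cdf_bounds
    by (auto intro!: decreasing_gain_loss_ratio[OF _ _ _ _ rf(4)] increasing_gain_loss_ratio[OF _ _ _ _ rf(4)])

  define w where "w = (\<lambda>\<omega>. \<epsilon>c (Suc t) \<omega> powr (-\<theta>) * \<epsilon>d (Suc t) \<omega>)"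
  define U where "U = E w"
  define V where "V = E (\<lambda>\<omega>. w \<omega> * F (\<epsilon>c (Suc t) \<omega>))"
  \<comment> \<open>The witness replaces the parameter-dependent conditional expectation by its
    linear expression in \<open>U\<close> and \<open>V\<close>, chosen once for all
    \<open>lam\<close> and \<open>b\<close>.\<close>
  define PD where "PD lam b \<omega> = \<beta> * ((1 + b * lam) * U \<omega> + b * (1 - lam) * V \<omega>) /
      (gain_loss_weight lam b (F (\<epsilon>c t \<omega>)) * (1 - \<beta> * U \<omega>))" for lam b \<omega>
  have w: "integrable M w" "\<forall>\<omega>\<in>space M. 0 < w \<omega>"
    using finite_expectations growth_pos by (simp_all add: w_def \<epsilon>c_def \<epsilon>d_def less_imp_neq[symmetric])
  have [measurable]: "U \<in> borel_measurable M" "V \<in> borel_measurable M"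
    by (simp_all add: U_def V_def E_def)
  have "version_of M (\<lambda>lam b. price_dividend_ratio M C D \<theta> \<beta> lam b t) PD"
    unfolding version_of_def
  proof (intro allI impI conjI)
    fix lam b :: real
    show "PD lam b \<in> borel_measurable M"
      unfolding PD_def F_def \<epsilon>c_def gain_loss_weight_def by measurable
    show "AE \<omega> in M. PD lam b \<omega> = price_dividend_ratio M C D \<theta> \<beta> lam b t \<omega>"
      using cond_exp_times_gain_loss[OF w(1), of t lam b "Suc t"]
      by eventually_elim
        (simp add: PD_def price_dividend_ratio_def U_def V_def E_def F_def w_def \<epsilon>c_def \<epsilon>d_def
          gain_loss_factor_eq_weight)
  qed
  moreover have "AE \<omega> in M. if F (\<epsilon>c t \<omega>) > V \<omega> / U \<omega>
      then increasing_in_each (\<lambda>lam b. PD lam b \<omega>) else decreasing_in_each (\<lambda>lam b. PD lam b \<omega>)"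
    \<comment> \<open>Neither fact involves \<open>lam\<close> or \<open>b\<close>, so one null set
      serves all parameters at once.\<close>
    using cond_exp_growth_cdf_bounds[OF w, of t "Suc t"] growth_condition
  proof eventually_elim
    case (elim \<omega>)
    then have U: "0 < U \<omega>" "0 \<le> V \<omega> / U \<omega>" "V \<omega> / U \<omega> \<le> 1" "\<beta> * U \<omega> < 1"
      by (simp_all add: U_def V_def E_def F_def \<epsilon>c_def w_def)
    \<comment> \<open>Compared with the return, the two weights have swapped places, which reverses
      the direction of monotonicity.\<close>
    have PD: "PD lam b \<omega> = \<beta> * U \<omega> / (1 - \<beta> * U \<omega>) *
        (gain_loss_weight lam b (V \<omega> / U \<omega>) / gain_loss_weight lam b (F (\<epsilon>c t \<omega>)))" for lam b
      using U(1) by (simp add: PD_def weighted_gain_loss mult.commute[of "1 - \<beta> * U \<omega>"])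
    \<comment> \<open>The growth condition makes the denominator positive.\<close>
    have k: "0 \<le> \<beta> * U \<omega> / (1 - \<beta> * U \<omega>)"
      using U params by simp
    have F: "0 \<le> F (\<epsilon>c t \<omega>)" "F (\<epsilon>c t \<omega>) \<le> 1"
      using growth_cdf_bounds by (simp_all add: F_def)
    show ?case
      using increasing_gain_loss_ratio[OF k U(2) _ F(2) PD] decreasing_gain_loss_ratio[OF k F(1) _ U(3) PD]
      by (simp add: not_less)
  qed
  ultimately show "\<exists>PD. version_of M (\<lambda>lam b. price_dividend_ratio M C D \<theta> \<beta> lam b t) PD \<and>
       (AE \<omega> in M.
         if F (\<epsilon>c t \<omega>) >
              E (\<lambda>\<omega>'. \<epsilon>c (Suc t) \<omega>' powr (-\<theta>) * \<epsilon>d (Suc t) \<omega>' * F (\<epsilon>c (Suc t) \<omega>')) \<omega> /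
              E (\<lambda>\<omega>'. \<epsilon>c (Suc t) \<omega>' powr (-\<theta>) * \<epsilon>d (Suc t) \<omega>') \<omega>
         then increasing_in_each (\<lambda>lam b. PD lam b \<omega>)
         else decreasing_in_each (\<lambda>lam b. PD lam b \<omega>))"
    unfolding U_def V_def w_def by blast
qed

end
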